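(* Let $x\in\mathbb{R}^n_+$, let $\mathcal{S}_M$ be a multi-band uncertainty set, let $i\in I$ be a constraint of (LPP), and let $(G,c)_x^i$ be the min-cost flow instance corresponding to $x$ and $i$. The solution $x$ is robust feasible with respect to $\mathcal{S}_M$ for constraint $i$ if and only if $$\sum_{j\in J}\bar a_{ij}x_j-c_i^*(x)\le b_i,$$ where $c_i^*(x)$ is the minimum cost of a flow of the instance $(G,c)_x^i$.
   Context: Let $I=\{1,\ldots,m\}$, $J=\{1,\ldots,n\}$. (LPP) is the linear program $\max\sum_{j\in J}c_jx_j$ s.t. $\sum_{j\in J}a_{ij}x_j\le b_i$ ($i\in I$), $x_j\ge0$ ($j\in J$), with real data, in which the coefficients $a_{ij}$ are uncertain. Multi-band uncertainty set $\mathcal{S}_M$: each $a_{ij}$ equals a nominal value $\bar a_{ij}\in\mathbb{R}$ plus a deviation. Let $K=\{K^-,\ldots,-1,0,1,\ldots,K^+\}$ (integers $K^-<0<K^+$) be the set of deviation bands. For each $i\in I,j\in J$, real deviation values $$-\infty<d_{ij}^{K^-}<\cdots<d_{ij}^{-1}<d_{ij}^{0}=0<d_{ij}^{1}<\cdots<d_{ij}^{K^+}<+\infty$$ are given; band $k\ne K^-$ corresponds to deviations in $(d_{ij}^{k-1},d_{ij}^k]$, and band $K^-$ to the single value $d_{ij}^{K^-}$. For each band $k\in K$ there are integers $l_k,u_k$ with $0\le l_k\le u_k\le n$, which are a lower and an upper bound on the number of coefficients of a constraint whose deviation falls in band $k$ (the same for every constraint $i$). It is assumed that $u_0=n$ and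 $\sum_{k\in K}l_k\le n$. For $x\ge0$ and $i\in I$, the maximum overall deviation $DEV_i(x,\mathcal{S}_M)$ is the optimal value of the 0-1 program $$\max\sum_{j\in J}\sum_{k\in K}d_{ij}^k\,x_j\,y_{ij}^k\quad\text{s.t.}\quad l_k\le\sum_{j\in J}y_{ij}^k\le u_k\ (k\in K),\quad \sum_{k\in K}y_{ij}^k\le1\ (j\in J),\quad y_{ij}^k\in\{0,1\}\ (j\in J,k\in K).$$ The vector $x$ is robust feasible with respect to $\mathcal{S}_M$ for constraint $i$ if $\sum_{j\in J}\bar a_{ij}x_j+DEV_i(x,\mathcal{S}_M)\le b_i$. Min-cost flow instance $(G,c)_x^i$: $G=(V,A)$ is the directed graph with vertices $V=\{v_j:j\in J\}\cup\{w_k:k\in K\}\cup\{s,t\}$ (all distinct) and arcs $A=A_1\cup A_2\cup A_3$, where $A_1=\{(s,v_j):j\in J\}$, $A_2=\{(v_j,w_k):j\in J,k\in K\}$, $A_3=\{(w_k,t):k\in K\}$. Each arc $a$ has a triple (lower bound on flow, upper bound on flow, cost per unit of flow $c_a$): it is $(0,1,0)$ for $a\in A_1$; $(0,1,-d_{ij}^kx_j)$ for $a=(v_j,w_k)\in A_2$; $(l_k,u_k,0)$ for $a=(w_k,t)\in A_3$. The amount of flow to be sent from $s$ to $t$ is $n$. $F_i$ denotes the set of feasible integral $(s,t)$-flows of value $n$ (respecting the arc bounds and flow conservation at all vertices other than $s,t$); the cost of $f\in F_i$ is $c(f)=\sum_{a\in A}c_af_a$, and $c_i^*(x)=\min_{f\in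 F_i}c(f)$. *)

theory Defs
  imports Complex_Main "HOL-Library.FuncSet" "Graph_Theory.Digraph"
begin

section \<open>Linear programs and multi-band uncertainty sets\<close>

text \<open>Variables and constraints are indexed from 1; matrices and vectors are functions on
  natural numbers of which only the values at these indices matter.  The coefficient matrix is not
  part of this record: it is uncertain, and its nominal value belongs to the uncertainty set.\<close>

record lpp =
  num_constrs :: nat
  num_vars :: nat
  objective :: "nat \<Rightarrow> real"
  rhs :: "nat \<Rightarrow> real"

definition constrs :: "lpp \<Rightarrow> nat set" where
  "constrs P = {1..num_constrs P}"

definition vars :: "lpp \<Rightarrow> nat set" where
  "vars P = {1..num_vars P}"

text \<open>\<open>deviation S i j k\<close> is $d_{ij}^k$.\<close>

record multiband =
  nominal :: "nat \<Rightarrow> nat \<Rightarrow> real"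
  min_band :: int
  max_band :: int
  deviation :: "nat \<Rightarrow> nat \<Rightarrow> int \<Rightarrow> real"
  band_lower :: "int \<Rightarrow> int"
  band_upper :: "int \<Rightarrow> int"

definition bands :: "multiband \<Rightarrow> int set" where
  "bands S = {min_band S..max_band S}"

definition multiband_uncertainty_set :: "lpp \<Rightarrow> multiband \<Rightarrow> bool" where
  "multiband_uncertainty_set P S \<longleftrightarrow>
     min_band S < 0 \<and> 0 < max_band S \<and>
     (\<forall>i\<in>constrs P. \<forall>j\<in>vars P.
        strict_mono_on (bands S) (deviation S i j) \<and> deviation S i j 0 = 0) \<and>
     (\<forall>k\<in>bands S. 0 \<le> band_lower S k \<and> band_lower S k \<le> band_upper S k \<and>
        band_upper S k \<le> int (num_vars P)) \<and>
     band_upper S 0 = int (num_vars P) \<and>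
     (\<Sum>k\<in>bands S. band_lower S k) \<le> int (num_vars P)"


section \<open>Maximum overall deviation and robust feasibility\<close>

text \<open>For a fixed constraint \<open>i\<close>, \<open>y (j, k)\<close> is $y_{ij}^k$.  The constraints of the 0-1 program
  do not depend on \<open>i\<close>.\<close>

definition band_assignments :: "lpp \<Rightarrow> multiband \<Rightarrow> (nat \<times> int \<Rightarrow> int) set" where
  "band_assignments P S =
     {y \<in> vars P \<times> bands S \<rightarrow>\<^sub>E {0, 1}.
        (\<forall>k\<in>bands S. band_lower S k \<le> (\<Sum>j\<in>vars P. y (j, k)) \<and>
           (\<Sum>j\<in>vars P. y (j, k)) \<le> band_upper S k) \<and>
        (\<forall>j\<in>vars P. (\<Sum>k\<in>bands S. y (j, k)) \<le> 1)}"

definition overall_deviation ::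
  "lpp \<Rightarrow> multiband \<Rightarrow> nat \<Rightarrow> (nat \<Rightarrow> real) \<Rightarrow> (nat \<times> int \<Rightarrow> int) \<Rightarrow> real" where
  "overall_deviation P S i x y =
     (\<Sum>j\<in>vars P. \<Sum>k\<in>bands S. deviation S i j k * x j * of_int (y (j, k)))"

definition DEV :: "lpp \<Rightarrow> multiband \<Rightarrow> nat \<Rightarrow> (nat \<Rightarrow> real) \<Rightarrow> real" where
  "DEV P S i x = Max (overall_deviation P S i x ` band_assignments P S)"

definition robust_feasible :: "lpp \<Rightarrow> multiband \<Rightarrow> nat \<Rightarrow> (nat \<Rightarrow> real) \<Rightarrow> bool" where
  "robust_feasible P S i x \<longleftrightarrow>
     (\<Sum>j\<in>vars P. nominal S i j * x j) + DEV P S i x \<le> rhs P i"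


section \<open>Minimum cost flows\<close>

record ('v, 'a) flow_instance =
  graph :: "('v, 'a) pre_digraph"
  source :: 'v
  sink :: 'v
  flow_lower :: "'a \<Rightarrow> real"
  flow_upper :: "'a \<Rightarrow> real"
  unit_cost :: "'a \<Rightarrow> real"
  amount :: real

text \<open>The amount of a flow is its net outflow at the source.\<close>

definition integral_flows :: "('v, 'a) flow_instance \<Rightarrow> ('a \<Rightarrow> real) set" where
  "integral_flows N =
     {f \<in> arcs (graph N) \<rightarrow>\<^sub>E \<int>.
        (\<forall>a\<in>arcs (graph N). flow_lower N a \<le> f a \<and> f a \<le> flow_upper N a) \<and>
        (\<forall>v\<in>verts (graph N) - {source N, sink N}.
           (\<Sum>a\<in>in_arcs (graph N) v. f a) = (\<Sum>a\<in>out_arcs (graph N) v. f a)) \<and>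
        (\<Sum>a\<in>out_arcs (graph N) (source N). f a)
          - (\<Sum>a\<in>in_arcs (graph N) (source N). f a) = amount N}"

definition flow_cost :: "('v, 'a) flow_instance \<Rightarrow> ('a \<Rightarrow> real) \<Rightarrow> real" where
  "flow_cost N f = (\<Sum>a\<in>arcs (graph N). unit_cost N a * f a)"

definition min_flow_cost :: "('v, 'a) flow_instance \<Rightarrow> real" where
  "min_flow_cost N = Min (flow_cost N ` integral_flows N)"


section \<open>The flow instance of a constraint\<close>

datatype vertex = Source | Sink | Var nat | Band int

type_synonym arc = "vertex \<times> vertex"

definition band_graph :: "lpp \<Rightarrow> multiband \<Rightarrow> (vertex, arc) pre_digraph" where
  "band_graph P S =
     \<lparr> verts = Var ` vars P \<union> Band ` bands S \<union> {Source, Sink},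
       arcs = {(Source, Var j) |j. j \<in> vars P}
            \<union> {(Var j, Band k) |j k. j \<in> vars P \<and> k \<in> bands S}
            \<union> {(Band k, Sink) |k. k \<in> bands S},
       tail = fst, head = snd \<rparr>"

fun band_arc_lower :: "multiband \<Rightarrow> arc \<Rightarrow> real" where
  "band_arc_lower S (Band k, Sink) = of_int (band_lower S k)"
| "band_arc_lower S _ = 0"

fun band_arc_upper :: "multiband \<Rightarrow> arc \<Rightarrow> real" where
  "band_arc_upper S (Band k, Sink) = of_int (band_upper S k)"
| "band_arc_upper S _ = 1"

fun band_arc_cost :: "multiband \<Rightarrow> nat \<Rightarrow> (nat \<Rightarrow> real) \<Rightarrow> arc \<Rightarrow> real" where
  "band_arc_cost S i x (Var j, Band k) = - deviation S i j k * x j"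
| "band_arc_cost S i x _ = 0"

definition band_flow_instance ::
  "lpp \<Rightarrow> multiband \<Rightarrow> nat \<Rightarrow> (nat \<Rightarrow> real) \<Rightarrow> (vertex, arc) flow_instance" where
  "band_flow_instance P S i x =
     \<lparr> graph = band_graph P S, source = Source, sink = Sink,
       flow_lower = band_arc_lower S, flow_upper = band_arc_upper S,
       unit_cost = band_arc_cost S i x, amount = real (num_vars P) \<rparr>"

end

theory Submission
  imports Defs "HOL-Library.Disjoint_Sets"
begin

text \<open>
  The flow instance encodes the 0-1 program behind \<open>DEV\<close>: the flow on the arc from
  \<open>Var j\<close> to \<open>Band k\<close> is the variable $y_{ij}^k$, the band bounds sit on the arcs into the sink,
  and the unit arcs out of the source allow each variable at most one band.  The only
  discrepancy is that a flow of value $n$ must saturate all $n$ source arcs, so that every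
  variable receives exactly one band, whereas the 0-1 program allows variables without a band.
  Band 0 removes it: its deviation is 0 and its upper bound is $n$, so putting all
  unassigned variables into band 0 keeps an assignment admissible and does not change its overall
  deviation (\<open>complete_band_assignment\<close>).  Hence the costs of integral flows are exactly the
  negatives of the overall deviations of assignments (\<open>flow_costs_eq_negated_deviations\<close>).

  Passing from equal value sets to \<open>min_flow_cost = - DEV\<close> needs that the minimum and the
  maximum are attained.  There are finitely many assignments, and there is at least one, because
  the lower bounds of the bands sum to at most $n$ (\<open>band_assignments_nonempty\<close>).
\<close>

lemma finite_vars [simp]: "finite (vars P)"
  by (simp add: vars_def)

lemma finite_bands [simp]: "finite (bands S)"
  by (simp add: bands_def)

lemma zero_in_bands:
  assumes "multiband_uncertainty_set P S"
  shows "0 \<in> bands S"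
  using assms by (simp add: multiband_uncertainty_set_def bands_def)


section \<open>Assignments of variables to bands\<close>

lemma band_assignmentsI:
  assumes "y \<in> vars P \<times> bands S \<rightarrow>\<^sub>E {0, 1}"
    and "\<And>k. k \<in> bands S \<Longrightarrow> band_lower S k \<le> (\<Sum>j\<in>vars P. y (j, k))"
    and "\<And>k. k \<in> bands S \<Longrightarrow> (\<Sum>j\<in>vars P. y (j, k)) \<le> band_upper S k"
    and "\<And>j. j \<in> vars P \<Longrightarrow> (\<Sum>k\<in>bands S. y (j, k)) \<le> 1"
  shows "y \<in> band_assignments P S"
  using assms by (simp add: band_assignments_def)

lemma finite_band_assignments: "finite (band_assignments P S)"
proof (rule finite_subset)
  show "band_assignments P S \<subseteq> vars P \<times> bands S \<rightarrow>\<^sub>E {0, 1}"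
    by (auto simp: band_assignments_def)
  show "finite (vars P \<times> bands S \<rightarrow>\<^sub>E ({0, 1} :: int set))"
    by (rule finite_PiE) auto
qed

lemma disjoint_subsets_of_given_cards:
  assumes "finite K" "finite J" "(\<Sum>k\<in>K. l k) \<le> card J"
  shows "\<exists>B. (\<forall>k\<in>K. B k \<subseteq> J \<and> card (B k) = l k) \<and> disjoint_family_on B K"
  using assms
proof (induction K arbitrary: J rule: finite_induct)
  case empty
  then show ?case by (simp add: disjoint_family_on_def)
next
  case (insert k K)
  then have "l k \<le> card J" by simp
  then obtain C where C: "C \<subseteq> J" "card C = l k"
    by (meson obtain_subset_with_card_n)
  with insert have "(\<Sum>k\<in>K. l k) \<le> card (J - C)"
    by (simp add: card_Diff_subset finite_subset)
  with insert.IH[of "J - C"] insert.prems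
  obtain B where B: "\<forall>k\<in>K. B k \<subseteq> J - C \<and> card (B k) = l k" "disjoint_family_on B K"
    by auto
  let ?B = "B(k := C)"
  have "\<forall>k'\<in>insert k K. ?B k' \<subseteq> J \<and> card (?B k') = l k'"
    using B C by auto
  moreover have "disjoint_family_on ?B (insert k K)"
    using B insert.hyps by (fastforce simp: disjoint_family_on_def)
  ultimately show ?case by blast
qed

text \<open>Meeting every lower bound with equality is possible because the lower bounds need no more
  than $n$ variables altogether.\<close>

lemma band_assignments_nonempty:
  assumes S: "multiband_uncertainty_set P S"
  shows "band_assignments P S \<noteq> {}"
proof -
  have lower: "0 \<le> band_lower S k" "band_lower S k \<le> band_upper S k" if "k \<in> bands S" for k
    using S that by (auto simp: multiband_uncertainty_set_def)
  have "int (\<Sum>k\<in>bands S. nat (band_lower S k)) = (\<Sum>k\<in>bands S. band_lower S k)"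
    unfolding of_nat_sum by (rule sum.cong) (auto simp: lower)
  also have "\<dots> \<le> int (card (vars P))"
    using S by (simp add: multiband_uncertainty_set_def vars_def)
  finally have "(\<Sum>k\<in>bands S. nat (band_lower S k)) \<le> card (vars P)"
    by (simp only: of_nat_le_iff)
  from disjoint_subsets_of_given_cards[OF finite_bands finite_vars this]
  obtain B where B: "\<And>k. k \<in> bands S \<Longrightarrow> B k \<subseteq> vars P"
      "\<And>k. k \<in> bands S \<Longrightarrow> card (B k) = nat (band_lower S k)"
      "disjoint_family_on B (bands S)"
    by blast
  define y :: "nat \<times> int \<Rightarrow> int"
    where "y = restrict (\<lambda>(j, k). of_bool (j \<in> B k)) (vars P \<times> bands S)"
  have "(\<Sum>j\<in>vars P. y (j, k)) = band_lower S k" if k: "k \<in> bands S" for k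
  proof -
    have "(\<Sum>j\<in>vars P. y (j, k)) = (\<Sum>j\<in>vars P. of_bool (j \<in> B k))"
      using k by (intro sum.cong) (auto simp: y_def)
    also have "\<dots> = int (card (vars P \<inter> B k))"
      by (simp add: sum_of_bool_eq)
    also have "\<dots> = band_lower S k"
      using B k lower by (simp add: Int_absorb1)
    finally show ?thesis .
  qed
  moreover have "(\<Sum>k\<in>bands S. y (j, k)) \<le> 1" if j: "j \<in> vars P" for j
  proof -
    have "(\<Sum>k\<in>bands S. y (j, k)) = (\<Sum>k\<in>bands S. of_bool (j \<in> B k))"
      using j by (intro sum.cong) (auto simp: y_def)
    also have "\<dots> = int (card (bands S \<inter> {k. j \<in> B k}))"
      by (simp add: sum_of_bool_eq)
    also have "card (bands S \<inter> {k. j \<in> B k}) \<le> 1"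
      using B(3) by (auto simp: card_le_Suc0_iff_eq disjoint_family_on_def)
    finally show ?thesis by simp
  qed
  moreover have "y \<in> vars P \<times> bands S \<rightarrow>\<^sub>E {0, 1}"
    by (auto simp: y_def)
  ultimately have "y \<in> band_assignments P S"
    using lower by (intro band_assignmentsI) auto
  then show ?thesis by blast
qed

text \<open>Variables without a band move to band 0.  This adds to band 0 alone, where the lower bound
  can only be helped, the upper bound $n$ cannot be exceeded, and the deviation 0 keeps the
  objective.\<close>

lemma complete_band_assignment:
  assumes S: "multiband_uncertainty_set P S" and i: "i \<in> constrs P"
    and y: "y \<in> band_assignments P S"
  obtains z where "z \<in> band_assignments P S"
    and "\<And>j. j \<in> vars P \<Longrightarrow> (\<Sum>k\<in>bands S. z (j, k)) = 1"
    and "overall_deviation P S i x z = overall_deviation P S i x y"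
proof -
  have y01: "y (j, k) \<in> {0, 1}" if "j \<in> vars P" "k \<in> bands S" for j k
    using y that by (auto simp: band_assignments_def)
  have row: "(\<Sum>k\<in>bands S. y (j, k)) \<le> 1" if "j \<in> vars P" for j
    using y that by (auto simp: band_assignments_def)
  have col: "band_lower S k \<le> (\<Sum>j\<in>vars P. y (j, k))"
      "(\<Sum>j\<in>vars P. y (j, k)) \<le> band_upper S k" if "k \<in> bands S" for k
    using y that by (auto simp: band_assignments_def)
  note 0 = zero_in_bands[OF S]
  \<comment> \<open>In row \<open>j\<close>, band 0 receives its old value plus the slack of the row.\<close>
  define z :: "nat \<times> int \<Rightarrow> int" where "z = restrict
    (\<lambda>(j, k). if k = 0 then 1 - (\<Sum>k\<in>bands S - {0}. y (j, k)) else y (j, k)) (vars P \<times> bands S)"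
  have z_zero: "z (j, 0) = 1 - (\<Sum>k\<in>bands S - {0}. y (j, k))" if "j \<in> vars P" for j
    using that 0 by (simp add: z_def)
  have z_other: "z (j, k) = y (j, k)" if "j \<in> vars P" "k \<in> bands S" "k \<noteq> 0" for j k
    using that by (simp add: z_def)
  have row_split: "(\<Sum>k\<in>bands S. g k) = g 0 + (\<Sum>k\<in>bands S - {0}. g k)" for g :: "int \<Rightarrow> int"
    using 0 by (simp add: sum.remove)
  have z_row: "(\<Sum>k\<in>bands S. z (j, k)) = 1" if "j \<in> vars P" for j
    unfolding row_split using that by (simp add: z_zero z_other)
  have z_ge: "y (j, 0) \<le> z (j, 0)" if "j \<in> vars P" for j
    using row[OF that] that unfolding row_split by (simp add: z_zero)
  have z_le: "z (j, 0) \<le> 1" if j: "j \<in> vars P" for j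
  proof -
    have "0 \<le> (\<Sum>k\<in>bands S - {0}. y (j, k))"
      using y01[OF j] by (intro sum_nonneg) force
    then show ?thesis using j by (simp add: z_zero)
  qed
  have "z (j, k) \<in> {0, 1}" if "j \<in> vars P" "k \<in> bands S" for j k
  proof (cases "k = 0")
    case True
    then show ?thesis
      using z_ge z_le y01 0 that by force
  next
    case False
    then show ?thesis using z_other y01 that by simp
  qed
  then have z_fun: "z \<in> vars P \<times> bands S \<rightarrow>\<^sub>E {0, 1}"
    by (auto simp: PiE_iff) (auto simp: z_def)
  have z_col: "band_lower S k \<le> (\<Sum>j\<in>vars P. z (j, k)) \<and> (\<Sum>j\<in>vars P. z (j, k)) \<le> band_upper S k"
    if k: "k \<in> bands S" for k
  proof (cases "k = 0")
    case True
    have "(\<Sum>j\<in>vars P. y (j, 0)) \<le> (\<Sum>j\<in>vars P. z (j, 0))"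
      by (intro sum_mono z_ge)
    moreover have "(\<Sum>j\<in>vars P. z (j, 0)) \<le> (\<Sum>j\<in>vars P. 1)"
      by (intro sum_mono z_le)
    moreover have "(\<Sum>j\<in>vars P. 1) = band_upper S 0"
      using S by (simp add: multiband_uncertainty_set_def vars_def)
    ultimately show ?thesis using col(1)[OF k] True by simp
  next
    case False
    then have "(\<Sum>j\<in>vars P. z (j, k)) = (\<Sum>j\<in>vars P. y (j, k))"
      using k by (intro sum.cong) (auto simp: z_other)
    then show ?thesis using col[OF k] by simp
  qed
  have "z \<in> band_assignments P S"
    using z_fun z_col z_row by (intro band_assignmentsI) auto
  moreover have "overall_deviation P S i x z = overall_deviation P S i x y"
    unfolding overall_deviation_def
  proof (intro sum.cong refl)
    fix j k assume "j \<in> vars P" "k \<in> bands S"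
    then show "deviation S i j k * x j * of_int (z (j, k)) =
        deviation S i j k * x j * of_int (y (j, k))"
      using S i z_other by (cases "k = 0") (auto simp: multiband_uncertainty_set_def)
  qed
  ultimately show thesis using that z_row by blast
qed


section \<open>Flows in the band graph\<close>

lemma band_graph_arcs:
  "arcs (band_graph P S) = (\<lambda>j. (Source, Var j)) ` vars P
     \<union> (\<lambda>(j, k). (Var j, Band k)) ` (vars P \<times> bands S) \<union> (\<lambda>k. (Band k, Sink)) ` bands S"
  by (auto simp: band_graph_def)

lemma finite_band_graph_arcs: "finite (arcs (band_graph P S))"
  by (simp add: band_graph_arcs)

lemma in_arcs_Var: "j \<in> vars P \<Longrightarrow> in_arcs (band_graph P S) (Var j) = {(Source, Var j)}"
  by (auto simp: in_arcs_def band_graph_def)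

lemma out_arcs_Var:
  "j \<in> vars P \<Longrightarrow> out_arcs (band_graph P S) (Var j) = (\<lambda>k. (Var j, Band k)) ` bands S"
  by (auto simp: out_arcs_def band_graph_def)

lemma in_arcs_Band:
  "k \<in> bands S \<Longrightarrow> in_arcs (band_graph P S) (Band k) = (\<lambda>j. (Var j, Band k)) ` vars P"
  by (auto simp: in_arcs_def band_graph_def)

lemma out_arcs_Band: "k \<in> bands S \<Longrightarrow> out_arcs (band_graph P S) (Band k) = {(Band k, Sink)}"
  by (auto simp: out_arcs_def band_graph_def)

lemma in_arcs_Source: "in_arcs (band_graph P S) Source = {}"
  by (auto simp: in_arcs_def band_graph_def)

lemma out_arcs_Source: "out_arcs (band_graph P S) Source = (\<lambda>j. (Source, Var j)) ` vars P"
  by (auto simp: out_arcs_def band_graph_def)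

lemmas band_graph_incidence =
  in_arcs_Var out_arcs_Var in_arcs_Band out_arcs_Band in_arcs_Source out_arcs_Source

text \<open>Spelling out bounds and conservation layer by layer turns a flow into a matrix
  \<open>f (Var j, Band k)\<close> whose row and column sums are the flows on the outer arcs.\<close>

lemma integral_flows_band_iff:
  "f \<in> integral_flows (band_flow_instance P S i x) \<longleftrightarrow>
     f \<in> arcs (band_graph P S) \<rightarrow>\<^sub>E \<int> \<and>
     (\<forall>j\<in>vars P. 0 \<le> f (Source, Var j) \<and> f (Source, Var j) \<le> 1) \<and>
     (\<forall>j\<in>vars P. \<forall>k\<in>bands S. 0 \<le> f (Var j, Band k) \<and> f (Var j, Band k) \<le> 1) \<and>
     (\<forall>k\<in>bands S. of_int (band_lower S k) \<le> f (Band k, Sink) \<and>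
        f (Band k, Sink) \<le> of_int (band_upper S k)) \<and>
     (\<forall>j\<in>vars P. f (Source, Var j) = (\<Sum>k\<in>bands S. f (Var j, Band k))) \<and>
     (\<forall>k\<in>bands S. (\<Sum>j\<in>vars P. f (Var j, Band k)) = f (Band k, Sink)) \<and>
     (\<Sum>j\<in>vars P. f (Source, Var j)) = real (num_vars P)"
proof -
  have bounds: "(\<forall>a\<in>arcs (band_graph P S). band_arc_lower S a \<le> f a \<and> f a \<le> band_arc_upper S a) \<longleftrightarrow>
     (\<forall>j\<in>vars P. 0 \<le> f (Source, Var j) \<and> f (Source, Var j) \<le> 1) \<and>
     (\<forall>j\<in>vars P. \<forall>k\<in>bands S. 0 \<le> f (Var j, Band k) \<and> f (Var j, Band k) \<le> 1) \<and>
     (\<forall>k\<in>bands S. of_int (band_lower S k) \<le> f (Band k, Sink) \<and>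
        f (Band k, Sink) \<le> of_int (band_upper S k))"
    by (simp add: band_graph_arcs ball_Un conj_assoc)
  have "verts (band_graph P S) - {Source, Sink} = Var ` vars P \<union> Band ` bands S"
    by (auto simp: band_graph_def)
  then have conservation: "(\<forall>v\<in>verts (band_graph P S) - {Source, Sink}.
      (\<Sum>a\<in>in_arcs (band_graph P S) v. f a) = (\<Sum>a\<in>out_arcs (band_graph P S) v. f a)) \<longleftrightarrow>
     (\<forall>j\<in>vars P. f (Source, Var j) = (\<Sum>k\<in>bands S. f (Var j, Band k))) \<and>
     (\<forall>k\<in>bands S. (\<Sum>j\<in>vars P. f (Var j, Band k)) = f (Band k, Sink))"
    by (simp add: ball_Un band_graph_incidence sum.reindex inj_on_def)
  show ?thesis
    unfolding integral_flows_def band_flow_instance_def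
    by (simp add: bounds conservation in_arcs_Source out_arcs_Source sum.reindex inj_on_def)
qed

text \<open>The outer arcs are free of charge, so only the middle layer contributes to the cost.\<close>

lemma flow_cost_band:
  "flow_cost (band_flow_instance P S i x) f =
     - (\<Sum>j\<in>vars P. \<Sum>k\<in>bands S. deviation S i j k * x j * f (Var j, Band k))"
proof -
  let ?c = "\<lambda>a. band_arc_cost S i x a * f a"
  let ?M = "(\<lambda>(j, k). (Var j, Band k)) ` (vars P \<times> bands S)"
  have "flow_cost (band_flow_instance P S i x) f = sum ?c (arcs (band_graph P S))"
    by (simp add: flow_cost_def band_flow_instance_def)
  also have "\<dots> = sum ?c ?M"
    by (rule sum.mono_neutral_right[OF finite_band_graph_arcs]) (auto simp: band_graph_def)
  also have "\<dots> = (\<Sum>(j, k)\<in>vars P \<times> bands S. ?c (Var j, Band k))"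
    by (subst sum.reindex) (auto simp: inj_on_def case_prod_beta)
  also have "\<dots> = (\<Sum>j\<in>vars P. \<Sum>k\<in>bands S. ?c (Var j, Band k))"
    by (simp add: sum.cartesian_product)
  finally show ?thesis by (simp add: sum_negf)
qed


section \<open>Flows and assignments\<close>

lemma flow_of_complete_band_assignment:
  assumes y: "y \<in> band_assignments P S"
    and complete: "\<And>j. j \<in> vars P \<Longrightarrow> (\<Sum>k\<in>bands S. y (j, k)) = 1"
  shows "\<exists>f\<in>integral_flows (band_flow_instance P S i x).
    flow_cost (band_flow_instance P S i x) f = - overall_deviation P S i x y"
proof -
  define f :: "arc \<Rightarrow> real" where "f = restrict
    (\<lambda>a. case a of (Var j, Band k) \<Rightarrow> of_int (y (j, k))
       | (Band k, Sink) \<Rightarrow> of_int (\<Sum>j\<in>vars P. y (j, k)) | _ \<Rightarrow> 1) (arcs (band_graph P S))"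
  have f_source: "f (Source, Var j) = 1" if "j \<in> vars P" for j
    using that by (simp add: f_def band_graph_def)
  have f_middle: "f (Var j, Band k) = of_int (y (j, k))" if "j \<in> vars P" "k \<in> bands S" for j k
    using that by (simp add: f_def band_graph_def)
  have f_sink: "f (Band k, Sink) = of_int (\<Sum>j\<in>vars P. y (j, k))" if "k \<in> bands S" for k
    using that by (simp add: f_def band_graph_def)
  have y01: "y (j, k) \<in> {0, 1}" if "j \<in> vars P" "k \<in> bands S" for j k
    using y that by (auto simp: band_assignments_def)
  have "f \<in> arcs (band_graph P S) \<rightarrow>\<^sub>E \<int>"
    unfolding f_def by (auto split: vertex.split simp del: of_int_sum)
  moreover have "0 \<le> f (Var j, Band k) \<and> f (Var j, Band k) \<le> 1"
    if "j \<in> vars P" "k \<in> bands S" for j k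
    using y01[OF that] that by (auto simp: f_middle)
  moreover have "of_int (band_lower S k) \<le> f (Band k, Sink) \<and>
      f (Band k, Sink) \<le> of_int (band_upper S k)" if "k \<in> bands S" for k
    unfolding f_sink[OF that] of_int_le_iff
    using y that by (simp add: band_assignments_def)
  moreover have "(\<Sum>k\<in>bands S. f (Var j, Band k)) = 1" if j: "j \<in> vars P" for j
  proof -
    have "(\<Sum>k\<in>bands S. f (Var j, Band k)) = of_int (\<Sum>k\<in>bands S. y (j, k))"
      using j by (simp add: f_middle)
    then show ?thesis using complete[OF j] by simp
  qed
  ultimately have "f \<in> integral_flows (band_flow_instance P S i x)"
    by (auto simp: integral_flows_band_iff f_source f_middle f_sink vars_def)
  moreover have "flow_cost (band_flow_instance P S i x) f = - overall_deviation P S i x y"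
    by (simp add: flow_cost_band overall_deviation_def f_middle)
  ultimately show ?thesis by blast
qed

text \<open>By integrality and the unit capacities, a flow is 0 or 1 on every arc of the middle layer,
  and is therefore an assignment there.\<close>

lemma band_assignment_of_flow:
  assumes f: "f \<in> integral_flows (band_flow_instance P S i x)"
  shows "\<exists>y\<in>band_assignments P S.
    flow_cost (band_flow_instance P S i x) f = - overall_deviation P S i x y"
proof -
  note flow = f[unfolded integral_flows_band_iff]
  define y :: "nat \<times> int \<Rightarrow> int"
    where "y = restrict (\<lambda>(j, k). \<lfloor>f (Var j, Band k)\<rfloor>) (vars P \<times> bands S)"
  have y_eq: "of_int (y (j, k)) = f (Var j, Band k)" if "j \<in> vars P" "k \<in> bands S" for j k
  proof -
    have "f (Var j, Band k) \<in> \<int>"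
      using flow that by (auto simp: PiE_iff band_graph_def)
    then show ?thesis using that by (simp add: y_def)
  qed
  have "y (j, k) \<in> {0, 1}" if "j \<in> vars P" "k \<in> bands S" for j k
  proof -
    have "(0 :: real) \<le> of_int (y (j, k))" "of_int (y (j, k)) \<le> (1 :: real)"
      using flow that by (simp_all add: y_eq)
    then show ?thesis by auto
  qed
  then have "y \<in> vars P \<times> bands S \<rightarrow>\<^sub>E {0, 1}"
    by (auto simp: PiE_iff) (auto simp: y_def)
  moreover have "band_lower S k \<le> (\<Sum>j\<in>vars P. y (j, k)) \<and> (\<Sum>j\<in>vars P. y (j, k)) \<le> band_upper S k"
    if k: "k \<in> bands S" for k
  proof -
    have "real_of_int (\<Sum>j\<in>vars P. y (j, k)) = f (Band k, Sink)"
      using flow k by (simp add: y_eq)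
    then show ?thesis using flow k by (metis of_int_le_iff)
  qed
  moreover have "(\<Sum>k\<in>bands S. y (j, k)) \<le> 1" if j: "j \<in> vars P" for j
  proof -
    have "real_of_int (\<Sum>k\<in>bands S. y (j, k)) = f (Source, Var j)"
      using flow j by (simp add: y_eq)
    then show ?thesis using flow j by (metis of_int_le_1_iff)
  qed
  ultimately have "y \<in> band_assignments P S"
    by (intro band_assignmentsI) auto
  moreover have "flow_cost (band_flow_instance P S i x) f = - overall_deviation P S i x y"
    by (simp add: flow_cost_band overall_deviation_def y_eq)
  ultimately show ?thesis by blast
qed

lemma flow_costs_eq_negated_deviations:
  assumes S: "multiband_uncertainty_set P S" and i: "i \<in> constrs P"
  shows "flow_cost (band_flow_instance P S i x) ` integral_flows (band_flow_instance P S i x) =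
    uminus ` overall_deviation P S i x ` band_assignments P S"
proof (intro equalityI subsetI)
  fix c assume "c \<in> flow_cost (band_flow_instance P S i x) `
    integral_flows (band_flow_instance P S i x)"
  then show "c \<in> uminus ` overall_deviation P S i x ` band_assignments P S"
    using band_assignment_of_flow by fastforce
next
  fix c assume "c \<in> uminus ` overall_deviation P S i x ` band_assignments P S"
  then obtain y where y: "y \<in> band_assignments P S" "c = - overall_deviation P S i x y"
    by blast
  obtain z where z: "z \<in> band_assignments P S"
      "\<And>j. j \<in> vars P \<Longrightarrow> (\<Sum>k\<in>bands S. z (j, k)) = 1"
      "overall_deviation P S i x z = overall_deviation P S i x y"
    using complete_band_assignment[OF S i y(1), of x] by blast
  then show "c \<in> flow_cost (band_flow_instance P S i x) `
      integral_flows (band_flow_instance P S i x)"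
    using flow_of_complete_band_assignment[OF z(1,2), of i x] y(2) by force
qed

theorem min_flow_cost_eq_neg_DEV:
  assumes "multiband_uncertainty_set P S" and "i \<in> constrs P"
  shows "min_flow_cost (band_flow_instance P S i x) = - DEV P S i x"
  unfolding min_flow_cost_def DEV_def flow_costs_eq_negated_deviations[OF assms]
  using finite_band_assignments band_assignments_nonempty[OF assms(1)]
  by (simp add: minus_Max_eq_Min)

theorem theorem2:
  fixes P :: lpp and S :: multiband and x :: "nat \<Rightarrow> real" and i :: nat
  assumes "multiband_uncertainty_set P S"
    and "\<forall>j\<in>vars P. 0 \<le> x j"
    and "i \<in> constrs P"
  shows "robust_feasible P S i x \<longleftrightarrow>
    (\<Sum>j\<in>vars P. nominal S i j * x j) - min_flow_cost (band_flow_instance P S i x) \<le> rhs P i"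
  by (simp add: robust_feasible_def min_flow_cost_eq_neg_DEV[OF assms(1,3)])

end
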